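(* Let $\mathbf{H}_{\mathbb{N}}^{\ast}$ be the collection of all subsets of $\mathbb{N}$ of the form $H_{\mathbb{N}}^{S}(A_q)$, where $S$ ranges over all semigroups and $(A_q)_{q\ge 1}$ ranges over all asymptotically strictly decreasing sequences of subsets of $S$. Then $$\mathbf{H}_{\mathbb{N}}^{\ast}=\{X\subseteq\mathbb{N}: 1\in X\}.$$
   Context: $\mathbb{N}=\{1,2,3,\dots\}$. For a subset $B$ of a (multiplicative) semigroup $S$ and $h\in\mathbb{N}$, the $h$-fold product set is $B^h=\{b_1\cdots b_h: b_1,\dots,b_h\in B\}$. For a sequence $(A_q)_{q\ge 1}$ of subsets of $S$, put $A=\bigcap_{q\ge 1}A_q$; its product intersection set is $$H_{\mathbb{N}}^{S}(A_q)=\Bigl\{h\in\mathbb{N}: A^h=\bigcap_{q\ge 1}A_q^h\Bigr\}.$$ A sequence $(A_q)_{q\ge1}$ of subsets of $S$ is asymptotically strictly decreasing if $A_{q+1}\subseteq A_q$ for all $q\ge 1$ and $A_q\neq A_{q+1}$ for infinitely many $q$. *)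

theory Defs
  imports Main
begin

text \<open>
  A semigroup is a carrier set \<open>S\<close> together with a binary operation \<open>f\<close> that is closed and
  associative on \<open>S\<close>; values of \<open>f\<close> outside \<open>S\<close> are irrelevant.  Carriers are sets rather than
  whole types so that one type holds semigroups of many cardinalities.
\<close>

definition semigroup_on :: "'a set \<Rightarrow> ('a \<Rightarrow> 'a \<Rightarrow> 'a) \<Rightarrow> bool" where
  "semigroup_on S f \<longleftrightarrow>
     (\<forall>x\<in>S. \<forall>y\<in>S. f x y \<in> S) \<and>
     (\<forall>x\<in>S. \<forall>y\<in>S. \<forall>z\<in>S. f (f x y) z = f x (f y z))"

text \<open>
  The product of the list \<open>b # bs\<close> is \<open>foldl f b bs\<close>, so no neutral element is needed.
  Only \<open>h \<ge> 1\<close> is meaningful (\<open>h = 0\<close> gives the empty set).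
\<close>

definition product_set :: "('a \<Rightarrow> 'a \<Rightarrow> 'a) \<Rightarrow> 'a set \<Rightarrow> nat \<Rightarrow> 'a set" where
  "product_set f B h = {foldl f b bs |b bs. set (b # bs) \<subseteq> B \<and> length (b # bs) = h}"

text \<open>
  Sequences are indexed by \<open>q \<ge> 1\<close>; the value at \<open>0\<close> is never used.
\<close>

definition product_intersection_set ::
    "('a \<Rightarrow> 'a \<Rightarrow> 'a) \<Rightarrow> (nat \<Rightarrow> 'a set) \<Rightarrow> nat set" where
  "product_intersection_set f A =
     {h. h \<ge> 1 \<and> product_set f (\<Inter>q\<in>{1..}. A q) h = (\<Inter>q\<in>{1..}. product_set f (A q) h)}"

definition asymp_strictly_decreasing :: "(nat \<Rightarrow> 'a set) \<Rightarrow> bool" where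
  "asymp_strictly_decreasing A \<longleftrightarrow>
     (\<forall>q\<ge>1. A (Suc q) \<subseteq> A q) \<and> infinite {q. q \<ge> 1 \<and> A q \<noteq> A (Suc q)}"

text \<open>
  HOL cannot quantify over all types inside a formula, so ``all semigroups'' is rendered as all
  semigroups whose carrier is a subset of the type \<open>'a\<close>, with \<open>'a\<close> left as a type parameter.
  Every semigroup has an isomorphic copy on a subset of a sufficiently large type, and an infinite
  type contains copies of all finite and countable ones.  Over a finite type the collection is
  empty for the trivial reason that no sequence of subsets can strictly decrease infinitely often.
\<close>

definition H_star :: "'a itself \<Rightarrow> nat set set" where
  "H_star TYPE('a) =
     {product_intersection_set f A |(S :: 'a set) f A.
        semigroup_on S f \<and> (\<forall>q\<ge>1. A q \<subseteq> S) \<and> asymp_strictly_decreasing A}"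

end

theory Submission
  imports Defs "HOL-Library.Countable"
begin

text \<open>
  The number 1 lies in every product intersection set because \<open>B\<^sup>1 = B\<close>.  Conversely, given
  \<open>X\<close> containing 1, one countable semigroup realizes it.  For every \<open>d\<close> there are generators
  \<open>x\<^bsub>d,0\<^esub>, x\<^bsub>d,1\<^esub>, \<dots>\<close> whose proper powers \<open>x\<^bsub>d,n\<^esub>\<^sup>k\<close> with \<open>k < d\<close> are all different.  For
  \<open>d \<ge> 2\<close>, if \<open>d \<notin> X\<close> then the \<open>d\<close>-th powers of all generators \<open>x\<^bsub>d,n\<^esub>\<close> are one common
  element \<open>z\<^bsub>d\<^esub>\<close>; all products not yet mentioned, among them \<open>x\<^bsub>d,n\<^esub>\<^sup>d\<close> for \<open>d \<in> X\<close>, are zero.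

  Let \<open>A\<^bsub>q\<^esub>\<close> consist of zero and all \<open>x\<^bsub>d,n\<^esub>\<close> with \<open>n \<ge> q\<close>.  These sets shrink to \<open>{0}\<close>, so
  \<open>A\<^sup>h = {0}\<close>.  A nonzero element of \<open>A\<^bsub>q\<^esub>\<^sup>h\<close> is either a power of some \<open>x\<^bsub>d,n\<^esub>\<close> with
  \<open>n \<ge> q\<close>, and then it drops out when \<open>q\<close> exceeds \<open>n\<close>, or it is \<open>z\<^bsub>h\<^esub>\<close> with \<open>h \<notin> X\<close>
  (\<open>tail_product_set_subset\<close>).  In the latter case it lies in every \<open>A\<^bsub>q\<^esub>\<^sup>h\<close>
  (\<open>top_in_tail_product_set\<close>).  Hence \<open>A\<^sup>h\<close> and the intersection of the \<open>A\<^bsub>q\<^esub>\<^sup>h\<close> differ exactly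
  for \<open>h \<notin> X\<close>.  An injection carries the semigroup into any given infinite type
  (\<open>product_intersection_set_image\<close>).
\<close>

section \<open>Product sets\<close>

lemma product_set_one: "product_set f B 1 = B"
  by (auto simp: product_set_def)

lemma product_set_idempotent:
  assumes "f e e = e" "h \<ge> 1"
  shows "product_set f {e} h = {e}"
proof -
  have fold: "foldl f e (replicate m e) = e" for m
    by (induction m) (simp_all add: assms)
  have "foldl f e bs = e" if "set bs \<subseteq> {e}" for bs
    using that assms by (induction bs) auto
  moreover have "e \<in> product_set f {e} h"
    unfolding product_set_def using assms(2) fold[of "h - 1"]
    by (intro CollectI exI[of _ e] exI[of _ "replicate (h - 1) e"]) auto
  ultimately show ?thesis
    by (auto simp: product_set_def)
qed

lemma product_set_image:
  assumes "\<And>x y. f' (g x) (g y) = g (f x y)"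
  shows "product_set f' (g ` B) h = g ` product_set f B h"
proof -
  have fold: "foldl f' (g b) (map g bs) = g (foldl f b bs)" for b bs
    by (induction bs arbitrary: b) (simp_all add: assms)
  show ?thesis
  proof (intro equalityI subsetI)
    fix y assume "y \<in> product_set f' (g ` B) h"
    then obtain c cs where y: "y = foldl f' c cs" "set (c # cs) \<subseteq> g ` B" "length (c # cs) = h"
      by (auto simp: product_set_def)
    then have "c # cs \<in> map g ` lists B"
      by (simp only: lists_image[symmetric] in_lists_conv_set) blast
    then obtain zs where "c # cs = map g zs" "zs \<in> lists B"
      by (rule imageE)
    then obtain b bs where "set (b # bs) \<subseteq> B" "c = g b" "cs = map g bs"
      by (cases zs) auto
    then show "y \<in> g ` product_set f B h"
      using y fold by (force simp: product_set_def)
  next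
    fix y assume "y \<in> g ` product_set f B h"
    then obtain b bs where "y = g (foldl f b bs)" "set (b # bs) \<subseteq> B" "length (b # bs) = h"
      by (auto simp: product_set_def)
    then show "y \<in> product_set f' (g ` B) h"
      unfolding product_set_def
      by (intro CollectI exI[of _ "g b"] exI[of _ "map g bs"]) (auto simp: fold)
  qed
qed

lemma product_intersection_set_image:
  assumes "inj g" "\<And>x y. f' (g x) (g y) = g (f x y)"
  shows "product_intersection_set f' (\<lambda>q. g ` A q) = product_intersection_set f A"
proof -
  have image_Inter: "(\<Inter>q\<in>{1..}. g ` B q) = g ` (\<Inter>q\<in>{1..}. B q)" for B :: "nat \<Rightarrow> _"
    using image_INT[of g UNIV "{1..}" B 1] assms(1) by simp
  show ?thesis
    unfolding product_intersection_set_def image_Inter product_set_image[of f' g f, OF assms(2)]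
    by (simp add: inj_image_eq_iff[OF assms(1)])
qed

section \<open>The nilpotent semigroup\<close>

text \<open>
  \<open>Power d n k\<close> is \<open>x\<^bsub>d,n\<^esub>\<close> to the power \<open>k + 1\<close>.  The shift excludes zeroth powers, for which
  associativity fails, and so makes the whole type a semigroup.  The terms with
  \<open>k > 0\<close> and \<open>k + 1 \<ge> d\<close> are not powers of generators; they never arise as products.
\<close>

datatype elt = Zero | Power nat nat nat | Top nat

instance elt :: countable
  by countable_datatype

fun mult :: "nat set \<Rightarrow> elt \<Rightarrow> elt \<Rightarrow> elt" where
  "mult X (Power d n k) (Power d' n' k') =
     (if d = d' \<and> n = n' then
        if k + k' + 2 < d then Power d n (k + k' + 1)
        else if k + k' + 2 = d \<and> d \<notin> X then Top d
        else Zero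
      else Zero)"
| "mult X _ _ = Zero"

lemma mult_Zero [simp]: "mult X Zero y = Zero" "mult X x Zero = Zero"
  by (simp, cases x, simp_all)

lemma mult_Top [simp]: "mult X (Top d) y = Zero" "mult X x (Top d) = Zero"
  by (simp, cases x, simp_all)

lemma mult_assoc: "mult X (mult X x y) z = mult X x (mult X y z)"
  by (cases x; cases y; cases z) auto

definition tail :: "nat \<Rightarrow> elt set" where
  "tail q = insert Zero {Power d n 0 |d n. q \<le> n}"

lemma Inter_tail: "(\<Inter>q\<in>{1..}. tail q) = {Zero}"
proof -
  have "Power d n k \<notin> tail (Suc n)" for d n k
    by (auto simp: tail_def)
  moreover have "Top d \<notin> tail 1" for d
    by (auto simp: tail_def)
  moreover have "Zero \<in> tail q" for q
    by (simp add: tail_def)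
  ultimately show ?thesis
    by (auto, metis One_nat_def atLeast_iff elt.exhaust le_add1 plus_1_eq_Suc)
qed

lemma asymp_strictly_decreasing_tail: "asymp_strictly_decreasing tail"
proof -
  have "Power 0 q 0 \<in> tail q - tail (Suc q)" for q
    by (auto simp: tail_def)
  then have "tail q \<noteq> tail (Suc q)" for q
    by blast
  then have "{q. 1 \<le> q \<and> tail q \<noteq> tail (Suc q)} = {1..}"
    by auto
  moreover have "tail (Suc q) \<subseteq> tail q" for q
    by (auto simp: tail_def)
  ultimately show ?thesis
    by (simp add: asymp_strictly_decreasing_def infinite_Ici)
qed

text \<open>
  A product of \<open>h\<close> generators is nonzero only if all factors agree, and an element \<open>z\<^bsub>d\<^esub>\<close> has
  exactly \<open>d\<close> factors because multiplying it by anything gives zero.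
\<close>

lemma tail_product_set_subset:
  "product_set (mult X) (tail q) h \<subseteq>
     insert Zero ({Power d n (h - 1) |d n. q \<le> n} \<union> (if h \<in> X then {} else {Top h}))"
proof -
  have "foldl (mult X) b bs \<in>
      insert Zero ({Power d n (length bs) |d n. q \<le> n} \<union>
        (if Suc (length bs) \<in> X then {} else {Top (Suc (length bs))}))"
    if "b \<in> tail q" "set bs \<subseteq> tail q" for b bs
    using that(2)
  proof (induction bs rule: rev_induct)
    case Nil
    then show ?case using that(1) by (auto simp: tail_def)
  next
    case (snoc c cs)
    then have c: "c \<in> tail q" by simp
    from snoc have "foldl (mult X) b cs \<in>
      insert Zero ({Power d n (length cs) |d n. q \<le> n} \<union>
        (if Suc (length cs) \<in> X then {} else {Top (Suc (length cs))}))" by simp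
    then consider "foldl (mult X) b cs = Zero" | "\<exists>d. foldl (mult X) b cs = Top d"
      | d n where "foldl (mult X) b cs = Power d n (length cs)" "q \<le> n"
      by (auto split: if_splits)
    then show ?case
      using c by cases (auto simp: tail_def split: if_splits)
  qed
  then show ?thesis
    by (fastforce simp: product_set_def)
qed

lemma Zero_in_tail_product_set:
  assumes "h \<ge> 1"
  shows "Zero \<in> product_set (mult X) (tail q) h"
proof -
  have "Zero \<in> product_set (mult X) {Zero} h"
    using product_set_idempotent[of "mult X" Zero h] assms by simp
  moreover have "product_set (mult X) {Zero} h \<subseteq> product_set (mult X) (tail q) h"
    by (fastforce simp: product_set_def tail_def)
  ultimately show ?thesis by blast
qed

lemma top_in_tail_product_set:
  assumes "h \<ge> 2" "h \<notin> X"
  shows "Top h \<in> product_set (mult X) (tail q) h"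
proof -
  let ?x = "Power h q 0"
  have powers: "foldl (mult X) ?x (replicate m ?x) = Power h q m" if "Suc m < h" for m
    using that by (induction m) (simp_all flip: replicate_append_same)
  from assms(1) obtain m where h: "h = Suc (Suc m)"
    by (metis One_nat_def Suc_1 Suc_le_D Suc_le_mono)
  have "foldl (mult X) ?x (replicate (Suc m) ?x) = mult X (Power h q m) ?x"
    using powers[of m] h by (simp add: replicate_append_same[symmetric] del: mult.simps)
  also have "\<dots> = Top h"
    using assms(2) h by simp
  finally show ?thesis
    unfolding product_set_def
    by (intro CollectI exI[of _ ?x] exI[of _ "replicate (Suc m) ?x"]) (auto simp: h tail_def)
qed

lemma product_intersection_set_tail:
  assumes "X \<subseteq> {1..}" "1 \<in> X"
  shows "product_intersection_set (mult X) tail = X"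
proof -
  have "product_set (mult X) {Zero} h = (\<Inter>q\<in>{1..}. product_set (mult X) (tail q) h) \<longleftrightarrow> h \<in> X"
    (is "_ = ?I \<longleftrightarrow> _") if "h \<ge> 1" for h
  proof
    assume eq: "product_set (mult X) {Zero} h = ?I"
    have "Top h \<notin> product_set (mult X) {Zero} h"
      using product_set_idempotent[of "mult X" Zero h] that by simp
    then have "\<not> (h \<ge> 2 \<and> h \<notin> X)"
      using top_in_tail_product_set[of h X] eq by blast
    then show "h \<in> X"
      using that assms(2) by (cases "h = 1") auto
  next
    assume "h \<in> X"
    then have sub: "product_set (mult X) (tail q) h \<subseteq> insert Zero {Power d n (h - 1) |d n. q \<le> n}"
      for q using tail_product_set_subset[of X q h] by simp
    have "?I \<subseteq> {Zero}"
    proof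
      fix y assume y: "y \<in> ?I"
      show "y \<in> {Zero}"
      proof (cases y)
        case (Power d n k)
        then have "Power d n k \<in> product_set (mult X) (tail (Suc n)) h" using y by simp
        then show ?thesis using sub[of "Suc n"] by auto
      next
        case (Top d)
        then have "Top d \<in> product_set (mult X) (tail 1) h" using y by simp
        then show ?thesis using sub[of 1] by auto
      qed simp
    qed
    moreover have "Zero \<in> ?I" using Zero_in_tail_product_set[OF that] by blast
    ultimately show "product_set (mult X) {Zero} h = ?I"
      using product_set_idempotent[of "mult X" Zero h] that by auto
  qed
  then show ?thesis
    using assms(1) unfolding product_intersection_set_def Inter_tail by auto
qed

section \<open>Realization in an arbitrary infinite type\<close>

lemma realize_in_infinite_type:
  assumes "infinite (UNIV :: 'a set)" "X \<subseteq> {1..}" "1 \<in> X"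
  shows "X \<in> H_star TYPE('a)"
proof -
  obtain e :: "nat \<Rightarrow> 'a" where "inj e"
    using assms(1) infinite_countable_subset by blast
  define g :: "elt \<Rightarrow> 'a" where "g = e \<circ> to_nat"
  have g: "inj g"
    unfolding g_def using \<open>inj e\<close> by (simp add: inj_compose)
  define f where "f = (\<lambda>x y. g (mult X (inv g x) (inv g y)))"
  have f: "f (g x) (g y) = g (mult X x y)" for x y
    by (simp add: f_def g)
  have "X = product_intersection_set f (\<lambda>q. g ` tail q)"
    using product_intersection_set_image[OF g, of f, OF f]
      product_intersection_set_tail[OF assms(2,3)] by simp
  moreover have "semigroup_on (range g) f"
    by (auto simp: semigroup_on_def f mult_assoc)
  moreover have "asymp_strictly_decreasing (\<lambda>q. g ` tail q)"
    using asymp_strictly_decreasing_tail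
    by (simp add: asymp_strictly_decreasing_def inj_image_eq_iff[OF g] inj_image_subset_iff[OF g])
  moreover have "\<forall>q\<ge>1. g ` tail q \<subseteq> range g"
    by blast
  ultimately show ?thesis
    unfolding H_star_def by blast
qed

theorem theorem1p1:
  assumes "infinite (UNIV :: 'a set)"
  shows "H_star TYPE('a) = {X. X \<subseteq> {1..} \<and> 1 \<in> X}"
proof (intro equalityI subsetI)
  fix X assume "X \<in> H_star TYPE('a)"
  then obtain f :: "'a \<Rightarrow> 'a \<Rightarrow> 'a" and A where "X = product_intersection_set f A"
    by (auto simp: H_star_def)
  then show "X \<in> {X. X \<subseteq> {1..} \<and> 1 \<in> X}"
    using product_set_one[of f] by (auto simp: product_intersection_set_def)
next
  fix X assume "X \<in> {X :: nat set. X \<subseteq> {1..} \<and> 1 \<in> X}"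
  then show "X \<in> H_star TYPE('a)"
    using realize_in_infinite_type[OF assms] by blast
qed

end
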